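(* Let $U$ and $Z$ be arbitrary (real) Hilbert spaces, and let $a:U\times U\to\mathbb{R}$, $b:Z\times U\to\mathbb{R}$, $d:U\times U\to\mathbb{R}$, $e:Z\times Z\to\mathbb{R}$ be arbitrary bounded bilinear forms such that $a$ and $e$ are coercive and $d$ is positive semi-definite. Let $f^\star:U\to\mathbb{R}$ and $g^\star:U\times Z\to\mathbb{R}$ be bounded linear forms. Then there exists a unique $({\bf u},{\bf z},{\bf p})\in U\times Z\times U$ that solves the saddle-point problem $$\begin{array}{lcll} d({\bf u},{\bf v})+e({\bf z},{\bf y})+a({\bf v},{\bf p})+b({\bf y},{\bf p})&=&g^\star\big(({\bf v},{\bf y})\big)&\text{for all }({\bf v},{\bf y})\in U\times Z,\\ a({\bf u},{\bf q})+b({\bf z},{\bf q})&=&f^\star({\bf q})&\text{for all }{\bf q}\in U,\end{array}$$ and $$\|{\bf u}\|_U+\|{\bf z}\|_Z+\|{\bf p}\|_U\le C_{\rm stab}\big(\|f^\star\|_{U'}+\|g^\star\|_{U'\times Z'}\big)$$ with a constant $C_{\rm stab}>0$ that depends only on the continuity constants of $a,b,d,e$ and the coercivity constants of $a,e$. Moreover, assuming symmetry of $d$ and $e$, the pair $({\bf u},{\bf z})\in U\times Z$ is the unique solution of the constrained minimization problem $$\operatorname*{argmin}_{\{({\bf u},{\bf z})\in U\times Z:\ a({\bf u},{\bf v})+b({\bf z},{\bf v})=f^\star({\bf v})\ \text{for all }{\bf v}\in U\}}\ \tfrac12 d({\bf u},{\bf u})+\tfrac12 e({\bf z},{\bf z})-g^\star\big(({\bf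 u},{\bf z})\big).$$
   Context: $U'$ and $Z'$ denote the dual spaces of $U$ and $Z$; $\|g^\star\|_{U'\times Z'}$ is the norm of the bounded linear form $g^\star$ on $U\times Z$, identified with an element of $U'\times Z'$. A bilinear form $a$ on $U\times U$ is coercive with coercivity constant $\alpha>0$ if $a({\bf v},{\bf v})\ge\alpha\|{\bf v}\|_U^2$ for all ${\bf v}\in U$ (analogously for $e$ on $Z\times Z$); $d$ is positive semi-definite if $d({\bf v},{\bf v})\ge0$ for all ${\bf v}\in U$. The continuity constant of a bounded bilinear form is its norm. No symmetry of $a$, $d$, $e$ is assumed except where stated. *)

theory Defs
  imports "HOL-Analysis.Analysis"
begin

text \<open>The norm (continuity constant) of a bilinear map, the analogue of \<^const>\<open>onorm\<close>.
  Pairs with \<open>x = 0\<close> or \<open>y = 0\<close> contribute the value \<open>0\<close>. The supremum is only meaningful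
  for maps satisfying \<^const>\<open>bounded_bilinear\<close>.\<close>

definition bilin_norm ::
    "('a::real_normed_vector \<Rightarrow> 'b::real_normed_vector \<Rightarrow> 'c::real_normed_vector) \<Rightarrow> real" where
  "bilin_norm B = (SUP (x, y). norm (B x y) / (norm x * norm y))"

definition coercive :: "real \<Rightarrow> ('a::real_normed_vector \<Rightarrow> 'a \<Rightarrow> real) \<Rightarrow> bool" where
  "coercive \<alpha> B \<longleftrightarrow> \<alpha> > 0 \<and> (\<forall>v. B v v \<ge> \<alpha> * (norm v)\<^sup>2)"

definition pos_semidef :: "('a \<Rightarrow> 'a \<Rightarrow> real) \<Rightarrow> bool" where
  "pos_semidef B \<longleftrightarrow> (\<forall>v. B v v \<ge> 0)"

definition symmetric_form :: "('a \<Rightarrow> 'a \<Rightarrow> real) \<Rightarrow> bool" where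
  "symmetric_form B \<longleftrightarrow> (\<forall>v w. B v w = B w v)"

definition state_eq ::
    "('u \<Rightarrow> 'u \<Rightarrow> real) \<Rightarrow> ('z \<Rightarrow> 'u \<Rightarrow> real) \<Rightarrow> ('u \<Rightarrow> real) \<Rightarrow> 'u \<Rightarrow> 'z \<Rightarrow> bool" where
  "state_eq a b f u z \<longleftrightarrow> (\<forall>q. a u q + b z q = f q)"

definition saddle_sol ::
    "('u \<Rightarrow> 'u \<Rightarrow> real) \<Rightarrow> ('z \<Rightarrow> 'u \<Rightarrow> real) \<Rightarrow> ('u \<Rightarrow> 'u \<Rightarrow> real) \<Rightarrow> ('z \<Rightarrow> 'z \<Rightarrow> real) \<Rightarrow>
     ('u \<Rightarrow> real) \<Rightarrow> ('u \<times> 'z \<Rightarrow> real) \<Rightarrow> 'u \<Rightarrow> 'z \<Rightarrow> 'u \<Rightarrow> bool" where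
  "saddle_sol a b d e f g u z p \<longleftrightarrow>
     (\<forall>v y. d u v + e z y + a v p + b y p = g (v, y)) \<and> state_eq a b f u z"

definition cost ::
    "('u \<Rightarrow> 'u \<Rightarrow> real) \<Rightarrow> ('z \<Rightarrow> 'z \<Rightarrow> real) \<Rightarrow> ('u \<times> 'z \<Rightarrow> real) \<Rightarrow> 'u \<times> 'z \<Rightarrow> real" where
  "cost d e g = (\<lambda>(u, z). 1 / 2 * d u u + 1 / 2 * e z z - g (u, z))"

text \<open>The stability constant must not depend on the Hilbert spaces. An existential quantifier
  inside a theorem about fixed types would allow it to depend on them, so it is a closed
  function of the continuity constants \<open>Mb\<close>, \<open>Md\<close> of \<open>b\<close>, \<open>d\<close> and the coercivity constants
  \<open>\<alpha>\<close>, \<open>\<epsilon>\<close> of \<open>a\<close>, \<open>e\<close>; the continuity constants of \<open>a\<close> and \<open>e\<close> are not needed.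

  Derivation: eliminating \<open>u\<close> through the second equation, \<open>u = u0 + T z\<close> with
  \<open>norm u0 \<le> norm f / \<alpha>\<close> and \<open>norm (T z) \<le> Mb / \<alpha> * norm z\<close>; testing the first equation with
  \<open>(T z, z)\<close> cancels \<open>p\<close> and bounds \<open>z\<close>; the second equation tested with \<open>u\<close> then bounds \<open>u\<close>,
  and the first one tested with \<open>(p, 0)\<close> bounds \<open>p\<close>. The factors \<open>cz\<close>, \<open>cu\<close>, \<open>cp\<close> are the resulting
  constants for \<open>z\<close>, \<open>u\<close>, \<open>p\<close>.\<close>

definition C_stab :: "real \<Rightarrow> real \<Rightarrow> real \<Rightarrow> real \<Rightarrow> real" where
  "C_stab Mb Md \<alpha> \<epsilon> =
     (let cz = (1 + Mb / \<alpha> + Md * Mb / \<alpha>\<^sup>2) / \<epsilon>;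
          cu = (1 + Mb * cz) / \<alpha>;
          cp = (1 + Md * cu) / \<alpha>
      in cu + cz + cp)"

end

theory Submission
  imports Defs
begin

text \<open>By the Lax-Milgram theorem, the constraint can be solved for \<open>u\<close>: it is equivalent to
  \<open>u = u0 - T z\<close> with \<open>T\<close> bounded and linear. Testing the first equation with \<open>(- T y, y)\<close>
  eliminates \<open>p\<close> and leaves a problem for \<open>z\<close> alone with the form \<open>d (T z) (T y) + e z y\<close>, which
  is again coercive. Given \<open>u\<close>, the multiplier \<open>p\<close> solves a problem for the transpose of \<open>a\<close>.
  Uniqueness is the stability estimate for vanishing data. Finally, moving from a solution in an
  admissible direction \<open>(v, y)\<close> changes the cost by exactly \<open>(d v v + e y y) / 2\<close>.\<close>

section \<open>The Riesz and Lax-Milgram theorems\<close>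

text \<open>The representer is the minimizer of \<open>J\<close>: a minimizing sequence is Cauchy by
  the parallelogram law, and the first variation of \<open>J\<close> vanishes at its limit.\<close>

lemma riesz_representation_exists:
  fixes f :: "'a::{real_inner, complete_space} \<Rightarrow> real"
  assumes "bounded_linear f"
  shows "\<exists>x. \<forall>v. x \<bullet> v = f v"
proof -
  interpret f: bounded_linear f by fact
  define J where "J x = (norm x)\<^sup>2 - 2 * f x" for x
  define m where "m = (INF x. J x)"
  obtain K where K: "norm (f x) \<le> norm x * K" for x
    using f.bounded by blast
  \<comment> \<open>Completing the square gives
    \<open>J x \<ge> (norm x - K)\<^sup>2 - K\<^sup>2\<close>.\<close>
  have J_lower: "J x \<ge> - K\<^sup>2" for x
  proof -
    have "f x \<le> norm x * K"
      using K[of x] by simp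
    moreover have "0 \<le> (norm x - K)\<^sup>2" by simp
    ultimately show ?thesis
      unfolding J_def power2_diff by (simp add: algebra_simps)
  qed
  have bdd: "bdd_below (range J)"
    using J_lower by (intro bdd_belowI[of _ "- K\<^sup>2"]) auto
  have m_le: "m \<le> J x" for x
    unfolding m_def by (rule cINF_lower[OF bdd]) simp
  have "\<exists>x. J x < m + 1 / real (Suc n)" for n
  proof -
    have "(INF x. J x) < m + 1 / real (Suc n)"
      unfolding m_def by simp
    then show ?thesis
      by (subst (asm) cINF_less_iff[OF _ bdd]) auto
  qed
  then obtain X where X: "J (X n) < m + 1 / real (Suc n)" for n
    by metis
  \<comment> \<open>The linear terms cancel because \<open>f\<close> is additive. Since
    \<open>J\<close> is at least \<open>m\<close> at the midpoint, two points with nearly minimal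
    \<open>J\<close> are close to each other.\<close>
  have parallelogram: "(norm (x - y))\<^sup>2 = 2 * J x + 2 * J y - 4 * J ((1/2) *\<^sub>R (x + y))" for x y
    unfolding J_def power2_norm_eq_inner f.scaleR f.add
    by (simp add: inner_simps inner_commute algebra_simps)
  have "Cauchy X"
  proof (rule CauchyI)
    fix r :: real
    assume r: "0 < r"
    \<comment> \<open>Two values of \<open>J\<close> below \<open>m + 1/N\<close> give a squared
      distance below \<open>4/N\<close>, which has to stay below \<open>r\<^sup>2\<close>.\<close>
    obtain N :: nat where N: "4 / r\<^sup>2 < real N"
      using reals_Archimedean2 by blast
    have "norm (X i - X j) < r" if "i \<ge> N" "j \<ge> N" for i j
    proof -
      have N_pos: "real N > 0"
        using N r by (smt (verit) divide_pos_pos zero_less_power)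
      have "1 / real (Suc k) \<le> 1 / real N" if "k \<ge> N" for k
        using N_pos that by (simp add: frac_le)
      then have "J (X i) < m + 1 / real N" "J (X j) < m + 1 / real N"
        using X[of i] X[of j] that by force+
      then have "(norm (X i - X j))\<^sup>2 < 4 / real N"
        using m_le[of "(1/2) *\<^sub>R (X i + X j)"] parallelogram[of "X i" "X j"] by simp
      also have "\<dots> < r\<^sup>2"
        using N r N_pos by (simp add: field_simps)
      finally show ?thesis
        using r by (simp add: power2_less_imp_less)
    qed
    then show "\<exists>M. \<forall>i\<ge>M. \<forall>j\<ge>M. norm (X i - X j) < r"
      by blast
  qed
  then obtain x where x: "X \<longlonglongrightarrow> x"
    using Cauchy_convergent convergent_def by blast
  have "(\<lambda>n. J (X n)) \<longlonglongrightarrow> J x"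
    unfolding J_def by (intro tendsto_intros f.tendsto x)
  moreover have "(\<lambda>n. m + 1 / real (Suc n)) \<longlonglongrightarrow> m + 0"
    by (intro tendsto_intros LIMSEQ_inverse_real_of_nat[unfolded inverse_eq_divide])
  ultimately have J_min: "J x \<le> m"
    using X by (intro LIMSEQ_le[of "\<lambda>n. J (X n)" _ "\<lambda>n. m + 1 / real (Suc n)"])
      (auto intro: less_imp_le)
  have "x \<bullet> v = f v" for v
  proof (cases "v = 0")
    case False
    define c where "c = x \<bullet> v - f v"
    \<comment> \<open>This \<open>t\<close> minimizes the quadratic
      \<open>J (x + t *\<^sub>R v)\<close>, whose derivative at \<open>0\<close> is
      \<open>2 * c\<close>.\<close>
    define t where "t = - c / (norm v)\<^sup>2"
    have "J (x + t *\<^sub>R v) = J x + (t\<^sup>2 * (norm v)\<^sup>2 + 2 * t * c)"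
      unfolding J_def c_def power2_norm_eq_inner f.scaleR f.add
      by (simp add: inner_simps inner_commute algebra_simps power2_eq_square)
    moreover have "t\<^sup>2 * (norm v)\<^sup>2 + 2 * t * c = - c\<^sup>2 / (norm v)\<^sup>2"
      using False unfolding t_def by (simp add: field_simps power2_eq_square)
    ultimately have "0 \<le> - c\<^sup>2 / (norm v)\<^sup>2"
      using J_min m_le[of "x + t *\<^sub>R v"] by simp
    then have "c\<^sup>2 \<le> 0"
      using False by (simp add: field_simps)
    then show ?thesis
      by (simp add: c_def)
  qed (simp add: f.zero)
  then show ?thesis by blast
qed

text \<open>One factor \<open>norm u\<close> cancels between coercivity and the upper bound. This
  turns testing an equation with its own solution into a norm bound, and with \<open>C = 0\<close>
  into \<open>u = 0\<close>.\<close>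

lemma coercive_norm_le:
  assumes "coercive \<alpha> B" "B u u \<le> C * norm u" "C \<ge> 0"
  shows "norm u \<le> C / \<alpha>"
proof (cases "u = 0")
  case False
  have "\<alpha> > 0" "\<alpha> * (norm u)\<^sup>2 \<le> C * norm u"
    using assms order_trans by (auto simp: coercive_def)
  then show ?thesis
    using False by (simp add: power2_eq_square field_simps)
qed (use assms in \<open>simp add: coercive_def\<close>)

text \<open>With \<open>a\<close> represented by an operator \<open>A\<close> and \<open>f\<close>
  by a vector \<open>r\<close>, the equation \<open>A x = r\<close> says that \<open>x\<close> is a
  fixed point of the damped iteration \<open>\<Phi>\<close>. A suitable damping makes
  \<open>\<Phi>\<close> a contraction, so Banach's theorem gives existence and uniqueness
  together.\<close>

theorem lax_milgram:
  fixes a :: "'a::{real_inner, complete_space} \<Rightarrow> 'a \<Rightarrow> real"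
  assumes "bounded_bilinear a" and coe: "coercive \<alpha> a" and "bounded_linear f"
  shows "\<exists>!u. \<forall>v. a u v = f v"
proof -
  interpret a: bounded_bilinear a by fact
  have \<alpha>: "\<alpha> > 0" and a_ge: "a v v \<ge> \<alpha> * (norm v)\<^sup>2" for v
    using coe by (auto simp: coercive_def)
  obtain K where K: "K > 0" "norm (a x y) \<le> norm x * norm y * K" for x y
    using a.pos_bounded by blast
  \<comment> \<open>Adding \<alpha> ensures \<open>\<alpha> < M\<close>, so that \<open>c\<close> is
    the root of a positive number even if \<open>K\<close> is below \<alpha>, as can happen on the
    trivial space.\<close>
  define M where "M = K + \<alpha>"
  have M: "\<alpha> < M" "0 < M" "norm (a x y) \<le> M * norm x * norm y" for x y
  proof -
    have "norm x * norm y * K \<le> M * norm x * norm y"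
      using \<alpha> by (simp add: M_def algebra_simps)
    then show "norm (a x y) \<le> M * norm x * norm y"
      using K(2)[of x y] by linarith
  qed (use \<alpha> K in \<open>auto simp: M_def\<close>)
  have "\<exists>h. \<forall>v. h \<bullet> v = a x v" for x
    by (rule riesz_representation_exists[OF a.bounded_linear_right])
  then obtain A where A: "A x \<bullet> v = a x v" for x v
    by metis
  obtain r where r: "r \<bullet> v = f v" for v
    using riesz_representation_exists[OF \<open>bounded_linear f\<close>] by blast
  \<comment> \<open>The squared contraction factor is at most
    \<open>1 - 2 * \<rho> * \<alpha> + \<rho>\<^sup>2 * M\<^sup>2\<close>; this \<rho> minimizes the
    bound, with minimum \<open>c\<^sup>2\<close>.\<close>
  define \<rho> where "\<rho> = \<alpha> / M\<^sup>2"
  define c where "c = sqrt (1 - \<alpha>\<^sup>2 / M\<^sup>2)"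
  have sq: "0 < \<alpha>\<^sup>2 / M\<^sup>2" "\<alpha>\<^sup>2 / M\<^sup>2 < 1"
    using \<alpha> M by (auto simp: power_strict_mono)
  have c: "0 \<le> c" "c < 1"
    using sq by (auto simp: c_def)
  define \<Phi> where "\<Phi> x = x - \<rho> *\<^sub>R (A x - r)" for x
  have "dist (\<Phi> x) (\<Phi> y) \<le> c * dist x y" for x y
  proof -
    define w where "w = x - y"
    define h where "h = A x - A y"
    have h: "h \<bullet> v = a w v" for v
      by (simp add: h_def w_def inner_diff_left A a.diff_left)
    have "norm h * norm h \<le> (M * norm w) * norm h"
      using M(3)[of w h] h[of h] by (simp flip: power2_norm_eq_inner add: power2_eq_square)
    then have "norm h \<le> M * norm w"
      using M(2) by (cases "h = 0") auto
    then have "(norm h)\<^sup>2 \<le> M\<^sup>2 * (norm w)\<^sup>2"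
      using power_mono[of "norm h" "M * norm w" 2] by (simp add: power_mult_distrib)
    then have "\<rho>\<^sup>2 * (norm h)\<^sup>2 \<le> \<rho>\<^sup>2 * (M\<^sup>2 * (norm w)\<^sup>2)"
      by (simp add: mult_left_mono)
    also have "\<dots> = \<alpha>\<^sup>2 / M\<^sup>2 * (norm w)\<^sup>2"
      using M(2) by (simp add: \<rho>_def field_simps power2_eq_square)
    finally have 1: "\<rho>\<^sup>2 * (norm h)\<^sup>2 \<le> \<alpha>\<^sup>2 / M\<^sup>2 * (norm w)\<^sup>2" .
    have "\<rho> * (\<alpha> * (norm w)\<^sup>2) \<le> \<rho> * (h \<bullet> w)"
      using a_ge[of w] h \<alpha> by (simp add: \<rho>_def divide_right_mono)
    moreover have "\<rho> * (\<alpha> * (norm w)\<^sup>2) = \<alpha>\<^sup>2 / M\<^sup>2 * (norm w)\<^sup>2"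
      by (simp add: \<rho>_def power2_eq_square)
    moreover have "(norm (w - \<rho> *\<^sub>R h))\<^sup>2 = (norm w)\<^sup>2 - 2 * (\<rho> * (h \<bullet> w)) + \<rho>\<^sup>2 * (norm h)\<^sup>2"
      unfolding power2_norm_eq_inner
      by (simp add: inner_simps inner_commute algebra_simps power2_eq_square)
    ultimately have "(norm (w - \<rho> *\<^sub>R h))\<^sup>2 \<le> (1 - \<alpha>\<^sup>2 / M\<^sup>2) * (norm w)\<^sup>2"
      using 1 by (simp add: algebra_simps)
    also have "\<dots> = (c * norm w)\<^sup>2"
      using sq by (simp add: c_def power_mult_distrib)
    finally have "norm (w - \<rho> *\<^sub>R h) \<le> c * norm w"
      by (rule power2_le_imp_le) (simp add: c)
    moreover have "\<Phi> x - \<Phi> y = w - \<rho> *\<^sub>R h"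
      by (simp add: \<Phi>_def w_def h_def algebra_simps)
    ultimately show ?thesis
      by (simp add: dist_norm w_def)
  qed
  then have "\<exists>!x. \<Phi> x = x"
    using banach_fix_type[OF c] by blast
  moreover have "\<Phi> x = x \<longleftrightarrow> (\<forall>v. a x v = f v)" for x
  proof -
    have "\<Phi> x = x \<longleftrightarrow> A x = r"
      using \<alpha> M by (simp add: \<Phi>_def \<rho>_def)
    also have "\<dots> \<longleftrightarrow> (\<forall>v. A x \<bullet> v = r \<bullet> v)"
      using vector_eq_rdot by metis
    finally show ?thesis
      by (simp add: A r)
  qed
  ultimately show ?thesis by simp
qed

text \<open>Uniqueness in Lax-Milgram makes the pointwise solutions linear in \<open>z\<close>, and
  coercivity bounds them. For the constraint, \<open>- T z\<close> is the response of the state to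
  \<open>z\<close>.\<close>

lemma lax_milgram_operator:
  fixes a :: "'a::{real_inner, complete_space} \<Rightarrow> 'a \<Rightarrow> real"
    and b :: "'b::real_normed_vector \<Rightarrow> 'a \<Rightarrow> real"
  assumes "bounded_bilinear a" and coe: "coercive \<alpha> a" and "bounded_bilinear b"
  obtains T where "bounded_linear T" "\<And>z v. a (T z) v = b z v"
proof -
  interpret a: bounded_bilinear a by fact
  interpret b: bounded_bilinear b by fact
  have unique: "\<exists>!u. \<forall>v. a u v = b z v" for z
    by (rule lax_milgram[OF assms(1) coe b.bounded_linear_right])
  then obtain T where T: "a (T z) v = b z v" for z v
    by metis
  obtain K where K: "K > 0" "norm (b x y) \<le> norm x * norm y * K" for x y
    using b.pos_bounded by blast
  have "bounded_linear T"
  proof (rule bounded_linear_intro)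
    show "T (x + y) = T x + T y" for x y
      using unique[of "x + y"] T by (metis a.add_left b.add_left)
    show "T (r *\<^sub>R x) = r *\<^sub>R T x" for r x
      using unique[of "r *\<^sub>R x"] T by (metis a.scaleR_left b.scaleR_left)
    show "norm (T x) \<le> norm x * (K / \<alpha>)" for x
      using coercive_norm_le[OF coe, of "T x" "norm x * K"] K(1) K(2)[of x "T x"] T
      by (simp add: ac_simps)
  qed
  with T show ?thesis
    using that by blast
qed

section \<open>Bounded bilinear forms\<close>

lemma bounded_bilinear_add:
  assumes "bounded_bilinear A" "bounded_bilinear B"
  shows "bounded_bilinear (\<lambda>x y. A x y + B x y)"
proof -
  interpret A: bounded_bilinear A by fact
  interpret B: bounded_bilinear B by fact
  obtain K L where K: "norm (A x y) \<le> norm x * norm y * K"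
      and L: "norm (B x y) \<le> norm x * norm y * L" for x y
    using A.bounded B.bounded by blast
  have "norm (A x y + B x y) \<le> norm x * norm y * (K + L)" for x y
    using norm_triangle_mono[OF K L] by (simp add: distrib_left)
  then show ?thesis
    by unfold_locales
      (auto simp: A.add_left A.add_right B.add_left B.add_right A.scaleR_left A.scaleR_right
        B.scaleR_left B.scaleR_right scaleR_add_right)
qed

text \<open>Boundedness makes the supremum in \<open>bilin_norm\<close> a genuine least upper
  bound.\<close>

lemma bdd_above_bilin_norm:
  assumes "bounded_bilinear B"
  shows "bdd_above (range (\<lambda>(x, y). norm (B x y) / (norm x * norm y)))"
proof -
  obtain K where K: "K > 0" "norm (B x y) \<le> norm x * norm y * K" for x y
    using bounded_bilinear.pos_bounded[OF assms] by blast
  have "norm (B x y) / (norm x * norm y) \<le> K" for x y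
  proof (cases "x = 0 \<or> y = 0")
    case False
    then show ?thesis
      using K(2)[of x y] by (simp add: divide_le_eq ac_simps)
  qed (use K(1) in auto)
  then show ?thesis
    by (auto intro!: bdd_aboveI)
qed

text \<open>The pair \<open>(0, 0)\<close> contributes \<open>0 / 0 = 0\<close> to the supremum, so
  this holds on trivial spaces too.\<close>

lemma bilin_norm_nonneg:
  assumes "bounded_bilinear B"
  shows "0 \<le> bilin_norm B"
  using cSUP_upper[OF UNIV_I bdd_above_bilin_norm[OF assms], of "(0, 0)"]
  by (simp add: bilin_norm_def)

lemma norm_le_bilin_norm:
  assumes "bounded_bilinear B"
  shows "norm (B x y) \<le> bilin_norm B * norm x * norm y"
proof (cases "x = 0 \<or> y = 0")
  case True
  then show ?thesis
    using bounded_bilinear.zero_left[OF assms] bounded_bilinear.zero_right[OF assms] by auto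
next
  case False
  have "norm (B x y) / (norm x * norm y) \<le> bilin_norm B"
    using cSUP_upper[OF UNIV_I bdd_above_bilin_norm[OF assms], of "(x, y)"]
    by (simp add: bilin_norm_def)
  then show ?thesis
    using False by (simp add: divide_le_eq ac_simps)
qed

section \<open>The saddle-point problem\<close>

text \<open>The data \<open>f\<close> and \<open>g\<close> are not fixed here, so that the stability
  estimate can be applied to zero data as well.\<close>

locale saddle_point_forms =
  a: bounded_bilinear a + b: bounded_bilinear b + d: bounded_bilinear d + e: bounded_bilinear e
  for a d :: "'u::{real_inner, complete_space} \<Rightarrow> 'u \<Rightarrow> real"
    and b :: "'z::{real_inner, complete_space} \<Rightarrow> 'u \<Rightarrow> real"
    and e :: "'z \<Rightarrow> 'z \<Rightarrow> real" +
  fixes \<alpha> \<epsilon> :: real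
  assumes coercive_a: "coercive \<alpha> a" and coercive_e: "coercive \<epsilon> e" and pos_d: "pos_semidef d"
begin

section \<open>Constants of the forms\<close>

lemma constants_pos: "\<alpha> > 0" "\<epsilon> > 0"
  using coercive_a coercive_e by (auto simp: coercive_def)

lemma bilin_norms_nonneg: "0 \<le> bilin_norm b" "0 \<le> bilin_norm d"
  by (simp_all add: bilin_norm_nonneg b.bounded_bilinear_axioms d.bounded_bilinear_axioms)

lemma b_le: "\<bar>b x y\<bar> \<le> bilin_norm b * norm x * norm y"
  using norm_le_bilin_norm[OF b.bounded_bilinear_axioms, of x y] by simp

lemma d_le: "\<bar>d x y\<bar> \<le> bilin_norm d * norm x * norm y"
  using norm_le_bilin_norm[OF d.bounded_bilinear_axioms, of x y] by simp

text \<open>The summand \<open>1\<close> in each numerator keeps the factors strictly positive even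
  when the norms of \<open>b\<close> and \<open>d\<close> vanish.\<close>

lemma C_stab_pos: "C_stab (bilin_norm b) (bilin_norm d) \<alpha> \<epsilon> > 0"
proof -
  define cz where "cz = (1 + bilin_norm b / \<alpha> + bilin_norm d * bilin_norm b / \<alpha>\<^sup>2) / \<epsilon>"
  define cu where "cu = (1 + bilin_norm b * cz) / \<alpha>"
  define cp where "cp = (1 + bilin_norm d * cu) / \<alpha>"
  have "cz > 0"
    using constants_pos bilin_norms_nonneg unfolding cz_def
    by (intro divide_pos_pos add_pos_nonneg) auto
  then have "cu > 0"
    using constants_pos bilin_norms_nonneg unfolding cu_def
    by (intro divide_pos_pos add_pos_nonneg) auto
  then have "cp > 0"
    using constants_pos bilin_norms_nonneg unfolding cp_def
    by (intro divide_pos_pos add_pos_nonneg) auto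
  then show ?thesis
    using \<open>cz > 0\<close> \<open>cu > 0\<close>
    unfolding C_stab_def Let_def cz_def[symmetric] cu_def[symmetric] cp_def[symmetric] by simp
qed

section \<open>Existence\<close>

lemma saddle_sol_exists:
  assumes "bounded_linear f" "bounded_linear g"
  shows "\<exists>u z p. saddle_sol a b d e f g u z p"
proof -
  interpret g: bounded_linear g by fact
  obtain T where T: "bounded_linear T" "\<And>z v. a (T z) v = b z v"
    using lax_milgram_operator[OF a.bounded_bilinear_axioms coercive_a b.bounded_bilinear_axioms]
    by blast
  obtain u0 where u0: "a u0 v = f v" for v
    using lax_milgram[OF a.bounded_bilinear_axioms coercive_a assms(1)] by blast
  \<comment> \<open>For the test pair \<open>(- T y, y)\<close> the terms with \<open>p\<close>
    cancel, as \<open>a (T y) p = b y p\<close>; inserting \<open>u = u0 - T z\<close> leaves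
    \<open>E\<close> on the left. Since \<open>d\<close> is positive semi-definite, \<open>E\<close>
    inherits the constant \<epsilon> of \<open>e\<close>.\<close>
  define E where "E z y = d (T z) (T y) + e z y" for z y
  have "bounded_bilinear E"
    unfolding E_def
    using d.comp[OF T(1) T(1)] e.bounded_bilinear_axioms by (rule bounded_bilinear_add)
  moreover have "coercive \<epsilon> E"
    using coercive_e pos_d by (auto simp: coercive_def pos_semidef_def E_def intro: add_increasing)
  moreover have "bounded_linear (\<lambda>y. g (- T y, y) + d u0 (T y))"
    by (intro bounded_linear_add bounded_linear_compose[OF assms(2)] bounded_linear_Pair
        bounded_linear_minus T bounded_linear_ident
        bounded_linear_compose[OF d.bounded_linear_right T(1)])
  ultimately obtain z where z: "E z y = g (- T y, y) + d u0 (T y)" for y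
    using lax_milgram by blast
  define u where "u = u0 - T z"
  \<comment> \<open>The test pairs \<open>(v, 0)\<close> determine \<open>p\<close>, which is the
    second argument of \<open>a\<close>; hence the transpose.\<close>
  have "bounded_linear (\<lambda>v. g (v, 0) - d u v)"
    by (intro bounded_linear_sub bounded_linear_compose[OF assms(2)] bounded_linear_Pair
        bounded_linear_ident bounded_linear_zero d.bounded_linear_right)
  moreover have "coercive \<alpha> (\<lambda>x y. a y x)"
    using coercive_a by (simp add: coercive_def)
  ultimately obtain p where p: "a v p = g (v, 0) - d u v" for v
    using lax_milgram[OF a.flip] by blast
  have "d u v + e z y + a v p + b y p = g (v, y)" for v y
  proof -
    \<comment> \<open>General test pairs reduce to the two kinds already solved:
      \<open>(v, y) = (v, 0) + (T y, 0) + (- T y, y)\<close>.\<close>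
    have "b y p = g (T y, 0) - d u (T y)"
      by (simp add: p flip: T(2))
    moreover have "g (v, y) = g (v, 0) + g (T y, 0) + g (- T y, y)"
      by (simp flip: g.add)
    ultimately show ?thesis
      using z[of y] p[of v] by (simp add: E_def u_def d.diff_left)
  qed
  moreover have "a u q + b z q = f q" for q
    by (simp add: u_def a.diff_left u0 T)
  ultimately show ?thesis
    unfolding saddle_sol_def state_eq_def by blast
qed

section \<open>Stability and uniqueness\<close>

lemma saddle_sol_stable:
  assumes "bounded_linear f" "bounded_linear g" and sol: "saddle_sol a b d e f g u z p"
  shows "norm u + norm z + norm p
    \<le> C_stab (bilin_norm b) (bilin_norm d) \<alpha> \<epsilon> * (onorm f + onorm g)"
proof -
  define Mb where "Mb = bilin_norm b"
  define Md where "Md = bilin_norm d"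
  define F where "F = onorm f"
  define G where "G = onorm g"
  define cz where "cz = (1 + Mb / \<alpha> + Md * Mb / \<alpha>\<^sup>2) / \<epsilon>"
  define cu where "cu = (1 + Mb * cz) / \<alpha>"
  define cp where "cp = (1 + Md * cu) / \<alpha>"
  note pos = constants_pos
  have nonneg: "0 \<le> Mb" "0 \<le> Md" "0 \<le> F" "0 \<le> G"
    using bilin_norms_nonneg onorm_pos_le assms by (auto simp: Mb_def Md_def F_def G_def)
  have f_le: "\<bar>f v\<bar> \<le> F * norm v" for v
    using onorm[OF assms(1), of v] by (simp add: F_def)
  have g_le: "\<bar>g v\<bar> \<le> G * norm v" for v
    using onorm[OF assms(2), of v] by (simp add: G_def)
  have eq1: "d u v + e z y + a v p + b y p = g (v, y)" and eq2: "a u q + b z q = f q" for v y q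
    using sol by (auto simp: saddle_sol_def state_eq_def)

  obtain u0 where u0: "a u0 v = f v" for v
    using lax_milgram[OF a.bounded_bilinear_axioms coercive_a assms(1)] by blast
  \<comment> \<open>\<open>w\<close> plays the role of \<open>T z\<close>: it solves
    \<open>a w v = b z v\<close>, and \<open>u = u0 - w\<close>.\<close>
  define w where "w = u0 - u"
  have w: "a w v = b z v" for v
    using eq2[of v] by (simp add: w_def a.diff_left u0)
  have u0_le: "norm u0 \<le> F / \<alpha>"
    using coercive_norm_le[OF coercive_a, of u0 F] u0[of u0] f_le[of u0] nonneg by simp
  have w_le: "norm w \<le> Mb / \<alpha> * norm z"
    using coercive_norm_le[OF coercive_a, of w "Mb * norm z"] w[of w] b_le[of z w] nonneg
    by (simp add: Mb_def)

  \<comment> \<open>Testing with \<open>(- w, z)\<close> removes \<open>p\<close>, and the term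
    \<open>d w w\<close> is dropped by its sign.\<close>
  have "e z z \<le> g (- w, z) + d u0 w"
  proof -
    have "d u (- w) + e z z = g (- w, z)"
      using eq1[of "- w" z] w[of p] by (simp add: a.minus_left)
    moreover have "d u (- w) = d w w - d u0 w"
    proof -
      have "u = u0 - w" by (simp add: w_def)
      then show ?thesis
        by (simp add: d.minus_right d.diff_left)
    qed
    ultimately show ?thesis
      using pos_d by (simp add: pos_semidef_def) (smt (verit))
  qed
  moreover have "g (- w, z) \<le> G * (1 + Mb / \<alpha>) * norm z"
  proof -
    have "norm (- w, z) \<le> norm w + norm z"
      using norm_Pair_le[of "- w" z] by simp
    also have "\<dots> \<le> (1 + Mb / \<alpha>) * norm z"
      using w_le by (simp add: algebra_simps)
    finally have "G * norm (- w, z) \<le> G * ((1 + Mb / \<alpha>) * norm z)"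
      using nonneg by (intro mult_left_mono)
    then show ?thesis
      using g_le[of "(- w, z)"] by (simp add: mult.assoc)
  qed
  moreover have "d u0 w \<le> F * (Md * Mb / \<alpha>\<^sup>2) * norm z"
  proof -
    have "d u0 w \<le> Md * (norm u0 * norm w)"
      using d_le[of u0 w] by (simp add: Md_def mult.assoc)
    also have "\<dots> \<le> Md * (F / \<alpha> * (Mb / \<alpha> * norm z))"
      using u0_le w_le nonneg pos by (intro mult_left_mono mult_mono) auto
    finally show ?thesis
      by (simp add: power2_eq_square ac_simps)
  qed
  ultimately have "e z z \<le> (G * (1 + Mb / \<alpha>) + F * (Md * Mb / \<alpha>\<^sup>2)) * norm z"
    unfolding distrib_right by linarith
  then have "norm z \<le> (G * (1 + Mb / \<alpha>) + F * (Md * Mb / \<alpha>\<^sup>2)) / \<epsilon>"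
    using nonneg pos by (intro coercive_norm_le[OF coercive_e]) auto
  \<comment> \<open>Mixed nonnegative terms are added so that a single factor multiplies
    \<open>F + G\<close>.\<close>
  also have "\<dots> \<le> (F + G) * (1 + Mb / \<alpha> + Md * Mb / \<alpha>\<^sup>2) / \<epsilon>"
  proof -
    have "0 \<le> F * (1 + Mb / \<alpha>) + G * (Md * Mb / \<alpha>\<^sup>2)"
      using nonneg pos by auto
    then have "G * (1 + Mb / \<alpha>) + F * (Md * Mb / \<alpha>\<^sup>2)
        \<le> (F + G) * (1 + Mb / \<alpha> + Md * Mb / \<alpha>\<^sup>2)"
      unfolding distrib_left distrib_right by linarith
    then show ?thesis
      using pos by (intro divide_right_mono) auto
  qed
  finally have z_le: "norm z \<le> cz * (F + G)"
    by (simp add: cz_def mult.commute)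

  \<comment> \<open>The second equation is tested with \<open>q = u\<close>.\<close>
  have "norm u \<le> (F + Mb * norm z) / \<alpha>"
    using coercive_norm_le[OF coercive_a, of u "F + Mb * norm z"]
      eq2[of u] f_le[of u] b_le[of z u] nonneg
    by (simp add: Mb_def algebra_simps)
  also have "\<dots> \<le> ((F + G) + Mb * (cz * (F + G))) / \<alpha>"
    using z_le nonneg pos by (intro divide_right_mono add_mono mult_left_mono) auto
  finally have u_le: "norm u \<le> cu * (F + G)"
    by (simp add: cu_def algebra_simps)

  \<comment> \<open>The first equation is tested with \<open>(p, 0)\<close>, where the terms of
    \<open>e\<close> and \<open>b\<close> vanish.\<close>
  have "norm (p, 0::'z) = norm p"
    by (simp add: norm_Pair)
  then have "norm p \<le> (G + Md * norm u) / \<alpha>"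
    using coercive_norm_le[OF coercive_a, of p "G + Md * norm u"]
      eq1[of p 0] g_le[of "(p, 0)"] d_le[of u p] nonneg
    by (simp add: Md_def algebra_simps e.zero_right b.zero_left)
  also have "\<dots> \<le> ((F + G) + Md * (cu * (F + G))) / \<alpha>"
    using u_le nonneg pos by (intro divide_right_mono add_mono mult_left_mono) auto
  finally have "norm p \<le> cp * (F + G)"
    by (simp add: cp_def algebra_simps)
  with u_le z_le have "norm u + norm z + norm p \<le> (cu + cz + cp) * (F + G)"
    by (simp add: distrib_right)
  then show ?thesis
    by (simp add: C_stab_def Let_def cz_def cu_def cp_def Mb_def Md_def F_def G_def)
qed

lemma saddle_sol_unique:
  assumes "saddle_sol a b d e f g u z p" "saddle_sol a b d e f g u' z' p'"
  shows "u = u' \<and> z = z' \<and> p = p'"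
proof -
  have "saddle_sol a b d e (\<lambda>_. 0) (\<lambda>_. 0) (u - u') (z - z') (p - p')"
    using assms unfolding saddle_sol_def state_eq_def
    by (simp add: a.diff_left a.diff_right b.diff_left b.diff_right d.diff_left e.diff_left)
      (smt (verit))
  from saddle_sol_stable[OF _ _ this]
  have "norm (u - u') + norm (z - z') + norm (p - p') \<le> 0"
    by (simp add: onorm_zero)
  then show ?thesis
    by (smt (verit) norm_ge_zero right_minus_eq zero_less_norm_iff)
qed

section \<open>Constrained minimization\<close>

lemma cost_expansion:
  assumes "bounded_linear g" and sol: "saddle_sol a b d e f g u z p"
    and "symmetric_form d" "symmetric_form e" and st: "state_eq a b f u' z'"
  shows "cost d e g (u', z')
    = cost d e g (u, z) + (d (u' - u) (u' - u) + e (z' - z) (z' - z)) / 2"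
proof -
  interpret g: bounded_linear g by fact
  have "d u (u' - u) + e z (z' - z) + a (u' - u) p + b (z' - z) p = g (u' - u, z' - z)"
    using sol by (simp add: saddle_sol_def)
  \<comment> \<open>Both pairs satisfy the constraint with the same \<open>f\<close>; subtracting at
    \<open>q = p\<close> removes the multiplier.\<close>
  moreover have "a (u' - u) p + b (z' - z) p = 0"
    using sol st by (simp add: saddle_sol_def state_eq_def a.diff_left b.diff_left) (smt (verit))
  moreover have "g (u' - u, z' - z) = g (u', z') - g (u, z)"
    by (simp flip: g.diff)
  \<comment> \<open>Symmetry merges the mixed terms of the quadratic cost, so that its first-order
    part is the left side of the first equation without \<open>p\<close>.\<close>
  moreover have "d u' u = d u u'" "e z' z = e z z'"
    using assms by (auto simp: symmetric_form_def)
  ultimately show ?thesis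
    by (simp add: cost_def d.diff_left d.diff_right e.diff_left e.diff_right field_simps)
qed

text \<open>As \<open>d\<close> may be degenerate, equal cost only forces \<open>z' = z\<close>, by
  coercivity of \<open>e\<close>; then the constraint and coercivity of \<open>a\<close> force
  \<open>u' = u\<close>. The equivalence for all \<open>w\<close> covers both existence and
  uniqueness of the minimizer.\<close>

lemma is_arg_min_iff:
  assumes "bounded_linear g" and sol: "saddle_sol a b d e f g u z p"
    and sym: "symmetric_form d" "symmetric_form e"
  shows "is_arg_min (cost d e g) (\<lambda>(u', z'). state_eq a b f u' z') w \<longleftrightarrow> w = (u, z)"
proof -
  have st: "state_eq a b f u z"
    using sol by (simp add: saddle_sol_def)
  have e_ge: "\<epsilon> * (norm y)\<^sup>2 \<le> e y y" and d_ge: "0 \<le> d v v" for v y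
    using coercive_e pos_d by (auto simp: coercive_def pos_semidef_def)
  have e_nonneg: "0 \<le> e y y" for y
    using e_ge[of y] constants_pos by (smt (verit) mult_nonneg_nonneg zero_le_power2)
  note expand = cost_expansion[OF assms(1) sol sym]
  have min: "cost d e g (u, z) \<le> cost d e g (u', z')" if "state_eq a b f u' z'" for u' z'
    using expand[OF that] d_ge[of "u' - u"] e_nonneg[of "z' - z"] by simp
  have unique: "(u', z') = (u, z)"
    if st': "state_eq a b f u' z'" and le: "cost d e g (u', z') \<le> cost d e g (u, z)" for u' z'
  proof -
    have "e (z' - z) (z' - z) \<le> 0"
      using expand[OF st'] le d_ge[of "u' - u"] by simp
    then have z': "z' = z"
      using coercive_norm_le[OF coercive_e, of "z' - z" 0] by simp
    have "a (u' - u) (u' - u) = 0"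
      using st st' by (simp add: state_eq_def z' a.diff_left) (smt (verit))
    then show ?thesis
      using coercive_norm_le[OF coercive_a, of "u' - u" 0] z' by simp
  qed
  show ?thesis
    unfolding is_arg_min_linorder using min unique st by (cases w) auto
qed

end

theorem lemma4p2:
  fixes a d :: "'u::{real_inner, complete_space} \<Rightarrow> 'u \<Rightarrow> real"
    and b :: "'z::{real_inner, complete_space} \<Rightarrow> 'u \<Rightarrow> real"
    and e :: "'z \<Rightarrow> 'z \<Rightarrow> real"
    and f :: "'u \<Rightarrow> real"
    and g :: "'u \<times> 'z \<Rightarrow> real"
    and \<alpha> \<epsilon> :: real
  assumes "bounded_bilinear a" and "bounded_bilinear b"
    and "bounded_bilinear d" and "bounded_bilinear e"
    and "coercive \<alpha> a" and "coercive \<epsilon> e" and "pos_semidef d"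
    and "bounded_linear f" and "bounded_linear g"
  shows "(\<exists>!(u, z, p). saddle_sol a b d e f g u z p) \<and>
    C_stab (bilin_norm b) (bilin_norm d) \<alpha> \<epsilon> > 0 \<and>
    (\<forall>u z p. saddle_sol a b d e f g u z p \<longrightarrow>
      norm u + norm z + norm p
        \<le> C_stab (bilin_norm b) (bilin_norm d) \<alpha> \<epsilon> * (onorm f + onorm g) \<and>
      (symmetric_form d \<and> symmetric_form e \<longrightarrow>
        (\<forall>w. is_arg_min (cost d e g) (\<lambda>(u', z'). state_eq a b f u' z') w \<longleftrightarrow> w = (u, z))))"
proof -
  interpret saddle_point_forms a d b e \<alpha> \<epsilon>
    using assms by (simp add: saddle_point_forms_def saddle_point_forms_axioms_def)
  have "\<exists>!(u, z, p). saddle_sol a b d e f g u z p"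
    using saddle_sol_exists[OF assms(8,9)] saddle_sol_unique by fastforce
  then show ?thesis
    using C_stab_pos saddle_sol_stable[OF assms(8,9)] is_arg_min_iff[OF assms(9)] by blast
qed

end
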